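(* Let $T$ be a Tychonoff space. Then the following conditions are equivalent: (1) $C_p(T)$ is $S$-separable; (2) $C_p(T)$ is $mS$-separable; (3) $C_p(T)$ is $M$-separable.
   Context: For a Tychonoff space $T$, $C_p(T)$ denotes the set of all continuous functions $f:T\to\mathbb R$ with the topology inherited from the Tychonoff power $\mathbb R^T$ (the topology of pointwise convergence). $\omega$ is the set of natural numbers, each $k\in\omega$ is identified with $\{0,\dots,k-1\}$, and $[D]^{<\omega}$ denotes the set of finite subsets of $D$. A topological space $X$ is $M$-separable if for every sequence $\langle D_n:n\in\omega\rangle$ of dense subsets of $X$ there are finite sets $F_n\subset D_n$, $n\in\omega$, such that $\bigcup_{n\in\omega}F_n$ is dense in $X$. $X$ is $S$-separable if for every sequence $\langle D_n:n\in\omega\rangle$ of dense subsets of $X$ there exists a sequence $\langle F_n:n\in\omega\rangle$ such that $F_n\in[D_n]^{<\omega}$ for all $n\in\omega$, and for every finite family $\{U_i:i\in k\}$ of non-empty open subsets of $X$ there exists $n\in\omega$ with $U_i\cap F_n\neq\emptyset$ for all $i\in k$. $X$ is $mS$-separable if the condition in the definition of $S$-separability holds for all decreasing sequences $\langle D_n:n\in\omega\rangle$ (i.e., $D_{n+1}\subset D_n$ for all $n$) of dense subsets of $X$. *)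

theory Defs
  imports "HOL-Analysis.Analysis"
begin

definition tychonoff_space :: "'a topology \<Rightarrow> bool" where
  "tychonoff_space T \<longleftrightarrow> completely_regular_space T \<and> Hausdorff_space T"

text \<open>A point of the product topology is a function that is undefined outside the index set, so
  the points of \<open>Cp T\<close> are the continuous real-valued functions on \<open>topspace T\<close>, each represented
  by a unique extensional function.\<close>

definition Cp :: "'a topology \<Rightarrow> ('a \<Rightarrow> real) topology" where
  "Cp T = subtopology (product_topology (\<lambda>_. euclideanreal) (topspace T))
            {f. continuous_map T euclideanreal f}"

definition dense_subset_of :: "'a topology \<Rightarrow> 'a set \<Rightarrow> bool" where
  "dense_subset_of X D \<longleftrightarrow> D \<subseteq> topspace X \<and> X closure_of D = topspace X"

definition M_separable :: "'a topology \<Rightarrow> bool" where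
  "M_separable X \<longleftrightarrow>
    (\<forall>D :: nat \<Rightarrow> 'a set. (\<forall>n. dense_subset_of X (D n)) \<longrightarrow>
      (\<exists>F. (\<forall>n. finite (F n) \<and> F n \<subseteq> D n) \<and> dense_subset_of X (\<Union>n. F n)))"

definition S_selection :: "'a topology \<Rightarrow> (nat \<Rightarrow> 'a set) \<Rightarrow> bool" where
  "S_selection X D \<longleftrightarrow>
    (\<exists>F. (\<forall>n. finite (F n) \<and> F n \<subseteq> D n) \<and>
      (\<forall>(k::nat) (U :: nat \<Rightarrow> 'a set). (\<forall>i<k. openin X (U i) \<and> U i \<noteq> {}) \<longrightarrow>
        (\<exists>n. \<forall>i<k. U i \<inter> F n \<noteq> {})))"

definition S_separable :: "'a topology \<Rightarrow> bool" where
  "S_separable X \<longleftrightarrow>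
    (\<forall>D. (\<forall>n. dense_subset_of X (D n)) \<longrightarrow> S_selection X D)"

definition mS_separable :: "'a topology \<Rightarrow> bool" where
  "mS_separable X \<longleftrightarrow>
    (\<forall>D. (\<forall>n. dense_subset_of X (D n)) \<and> (\<forall>n. D (Suc n) \<subseteq> D n) \<longrightarrow> S_selection X D)"

end

theory Submission
  imports Defs
begin

text \<open>If \<open>Cp T\<close> is \<open>M\<close>-separable, then from every sequence of open \<open>\<omega>\<close>-covers of \<open>T\<close> one can select
  finitely many members of each so that the selected sets again form an \<open>\<omega>\<close>-cover. Given dense sets
  \<open>D n\<close>, targets \<open>h 0, \<dots>, h (k - 1)\<close> and \<open>\<epsilon> > 0\<close>, the sets \<open>{x. \<forall>i<k. \<bar>f i x - h i x\<bar> < \<epsilon>}\<close>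
  with \<open>f i \<in> D n\<close> form such a cover, and a selection of members is a selection of finitely many
  points of \<open>D n\<close> that approximates all \<open>k\<close> targets at once. As \<open>Cp T\<close> is separable, countably many
  choices of targets and \<open>\<epsilon>\<close> suffice, and each is served by its own infinite set of indices \<open>n\<close>.\<close>

section \<open>Density in terms of nonempty open sets\<close>

lemma dense_subset_of_meets:
  assumes "dense_subset_of X D" "openin X U" "U \<noteq> {}"
  shows "\<exists>x\<in>D. x \<in> U"
  using assms unfolding dense_subset_of_def
  by (metis dense_intersects_open disjoint_iff)

lemma dense_subset_ofI:
  assumes "D \<subseteq> topspace X" "\<And>U. openin X U \<Longrightarrow> U \<noteq> {} \<Longrightarrow> \<exists>x\<in>D. x \<in> U"
  shows "dense_subset_of X D"
  using assms unfolding dense_subset_of_def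
  by (metis dense_intersects_open disjoint_iff)

section \<open>Basic neighbourhoods in \<open>Cp T\<close>\<close>

definition Cp_ball :: "'a topology \<Rightarrow> ('a \<Rightarrow> real) \<Rightarrow> 'a set \<Rightarrow> real \<Rightarrow> ('a \<Rightarrow> real) set" where
  "Cp_ball T h K e = {f \<in> topspace (Cp T). \<forall>x\<in>K. \<bar>f x - h x\<bar> < e}"

lemma topspace_Cp:
  "topspace (Cp T) = {f \<in> extensional (topspace T). continuous_map T euclideanreal f}"
  by (auto simp: Cp_def PiE_def)

lemma zero_in_Cp: "restrict (\<lambda>_. 0) (topspace T) \<in> topspace (Cp T)"
proof -
  have "continuous_map T euclideanreal (restrict (\<lambda>_. 0) (topspace T))"
    by (rule continuous_map_eq[of _ _ "\<lambda>_. 0"]) auto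
  then show ?thesis
    by (simp add: topspace_Cp)
qed

lemma openin_Cp_ball:
  assumes "finite K" "K \<subseteq> topspace T"
  shows "openin (Cp T) (Cp_ball T h K e)"
proof -
  have "openin (Cp T) {f \<in> topspace (Cp T). f x \<in> {h x - e<..<h x + e}}" if "x \<in> K" for x
  proof (rule openin_continuous_map_preimage)
    show "continuous_map (Cp T) euclideanreal (\<lambda>f. f x)"
      unfolding Cp_def using that assms
      by (intro continuous_map_from_subtopology continuous_map_product_projection) auto
    show "openin euclideanreal {h x - e<..<h x + e}"
      by (simp flip: open_openin)
  qed
  \<comment> \<open>The factor \<open>topspace (Cp T)\<close> takes care of \<open>K = {}\<close>,
    where the bare intersection is \<open>UNIV\<close>.\<close>
  then have "openin (Cp T)
      (topspace (Cp T) \<inter> (\<Inter>x\<in>K. {f \<in> topspace (Cp T). f x \<in> {h x - e<..<h x + e}}))"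
    using assms(1) by (intro openin_Int_Inter) auto
  also have "topspace (Cp T) \<inter> (\<Inter>x\<in>K. {f \<in> topspace (Cp T). f x \<in> {h x - e<..<h x + e}})
      = Cp_ball T h K e"
    by (fastforce simp: Cp_ball_def abs_less_iff)
  finally show ?thesis .
qed

text \<open>A basic box restricts only finitely many coordinates, and the least of the radii at
  these coordinates serves them all.\<close>

lemma openin_Cp_contains_ball:
  assumes "openin (Cp T) U" "h \<in> U"
  obtains K e where "finite K" "K \<subseteq> topspace T" "0 < e" "Cp_ball T h K e \<subseteq> U"
proof -
  obtain S where S: "openin (product_topology (\<lambda>_. euclideanreal) (topspace T)) S"
    and U: "U = S \<inter> {f. continuous_map T euclideanreal f}"
    using assms(1) unfolding Cp_def openin_subtopology by blast
  then have "h \<in> S"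
    using assms(2) by blast
  then obtain V where fin: "finite {x \<in> topspace T. V x \<noteq> UNIV}"
    and opn: "\<And>x. x \<in> topspace T \<Longrightarrow> open (V x)"
    and h: "h \<in> Pi\<^sub>E (topspace T) V" and VS: "Pi\<^sub>E (topspace T) V \<subseteq> S"
    using S unfolding openin_product_topology_alt by (auto simp del: PiE_iff)
  define K where "K = {x \<in> topspace T. V x \<noteq> UNIV}"
  have K: "finite K" "K \<subseteq> topspace T"
    using fin by (auto simp: K_def)
  have "\<exists>d>0. \<forall>y. \<bar>y - h x\<bar> < d \<longrightarrow> y \<in> V x" if "x \<in> K" for x
    using opn[of x] h that K(2) unfolding open_dist dist_real_def by (auto simp: PiE_iff)
  then obtain d where d: "\<And>x. x \<in> K \<Longrightarrow> 0 < d x"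
    "\<And>x y. x \<in> K \<Longrightarrow> \<bar>y - h x\<bar> < d x \<Longrightarrow> y \<in> V x"
    by metis
  \<comment> \<open>Inserting 1 keeps \<open>Min\<close> meaningful when no coordinate is
    restricted.\<close>
  define e where "e = Min (insert 1 (d ` K))"
  have "0 < e"
    unfolding e_def using K d(1) by (subst Min_gr_iff) auto
  have ed: "e \<le> d x" if "x \<in> K" for x
    unfolding e_def using K that by (intro Min_le) auto
  have "Cp_ball T h K e \<subseteq> U"
  proof
    fix f assume f: "f \<in> Cp_ball T h K e"
    have "f x \<in> V x" if "x \<in> topspace T" for x
    proof (cases "V x = UNIV")
      case False
      then have "x \<in> K" using that by (simp add: K_def)
      moreover from this have "\<bar>f x - h x\<bar> < e" using f by (simp add: Cp_ball_def)
      ultimately show ?thesis using d(2)[of x "f x"] ed[of x] by linarith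
    qed auto
    then have "f \<in> Pi\<^sub>E (topspace T) V"
      using f by (auto simp: Cp_ball_def topspace_Cp PiE_def)
    then show "f \<in> U"
      using VS U f by (auto simp: Cp_ball_def topspace_Cp)
  qed
  then show thesis
    using that[of K e] K \<open>0 < e\<close> by blast
qed

section \<open>Selection from open omega-covers\<close>

text \<open>The functions that equal 1 off some member of an \<open>\<omega>\<close>-cover form a dense set, and a
  function below 1 on \<open>K\<close> that equals 1 off \<open>W\<close> witnesses \<open>K \<subseteq> W\<close>.\<close>

lemma M_separable_Cp_omega_cover_selection:
  fixes W :: "nat \<Rightarrow> 'b \<Rightarrow> 'a set"
  assumes T: "completely_regular_space T" and M: "M_separable (Cp T)"
    and opn: "\<And>n a. a \<in> I n \<Longrightarrow> openin T (W n a)"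
    and cover: "\<And>n K. finite K \<Longrightarrow> K \<subseteq> topspace T \<Longrightarrow> \<exists>a\<in>I n. K \<subseteq> W n a"
  shows "\<exists>G. (\<forall>n. finite (G n) \<and> G n \<subseteq> I n) \<and>
    (\<forall>K. finite K \<and> K \<subseteq> topspace T \<longrightarrow> (\<exists>n. \<exists>a\<in>G n. K \<subseteq> W n a))"
proof -
  define E where
    "E n = {g \<in> topspace (Cp T). \<exists>a\<in>I n. \<forall>x\<in>topspace T - W n a. g x = 1}" for n
  have "dense_subset_of (Cp T) (E n)" for n
  proof (rule dense_subset_ofI)
    fix U assume U: "openin (Cp T) U" "U \<noteq> {}"
    then obtain h where h: "h \<in> U" by blast
    then have hC: "continuous_map T euclideanreal h"
      using U(1) openin_subset topspace_Cp by blast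
    obtain K e where K: "finite K" "K \<subseteq> topspace T" "0 < e" "Cp_ball T h K e \<subseteq> U"
      using openin_Cp_contains_ball[OF U(1) h] .
    obtain a where a: "a \<in> I n" "K \<subseteq> W n a"
      using cover K by blast
    have "compactin T K" "closedin T (topspace T - W n a)" "disjnt K (topspace T - W n a)"
      using K a opn[OF a(1)] by (auto simp: finite_imp_compactin disjnt_iff)
    then obtain v where v: "continuous_map T euclideanreal v" "v ` K \<subseteq> {0::real}"
      "v ` (topspace T - W n a) \<subseteq> {1}"
      using Urysohn_completely_regular_compact_closed_alt[OF T] by metis
    \<comment> \<open>This interpolates between \<open>h\<close> on \<open>K\<close>, where
      \<open>v\<close> is 0, and the constant 1 off \<open>W n a\<close>, where \<open>v\<close> is
      1.\<close>
    let ?g = "restrict (\<lambda>x. (1 - v x) * h x + v x) (topspace T)"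
    have "continuous_map T euclideanreal (\<lambda>x. (1 - v x) * h x + v x)"
      using v(1) hC by (intro continuous_intros) auto
    then have "continuous_map T euclideanreal ?g"
      by (rule continuous_map_eq) simp
    then have g: "?g \<in> topspace (Cp T)"
      by (simp add: topspace_Cp)
    then have "?g \<in> E n"
      using a v(3) unfolding E_def by fastforce
    moreover have "?g \<in> Cp_ball T h K e"
      using g v(2) K by (force simp: Cp_ball_def)
    ultimately show "\<exists>g\<in>E n. g \<in> U"
      using K by blast
  qed (auto simp: E_def)
  then obtain F where F: "\<And>n. finite (F n)" "\<And>n. F n \<subseteq> E n"
    and dF: "dense_subset_of (Cp T) (\<Union>n. F n)"
    using M unfolding M_separable_def by metis
  \<comment> \<open>One index is fixed for each function, so the finite set \<open>F n\<close>
    yields finitely many indices.\<close>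
  have "\<forall>n g. \<exists>a. g \<in> E n \<longrightarrow> a \<in> I n \<and> (\<forall>x\<in>topspace T - W n a. g x = 1)"
    unfolding E_def by blast
  then obtain c where c: "\<And>n g. g \<in> E n \<Longrightarrow> c n g \<in> I n"
    "\<And>n g x. g \<in> E n \<Longrightarrow> x \<in> topspace T - W n (c n g) \<Longrightarrow> g x = 1"
    by metis
  show ?thesis
  proof (intro exI[of _ "\<lambda>n. c n ` F n"] conjI allI impI)
    fix n
    show "finite (c n ` F n)" "c n ` F n \<subseteq> I n"
      using F c(1) by blast+
  next
    fix K assume K: "finite K \<and> K \<subseteq> topspace T"
    let ?z = "restrict (\<lambda>_. 0::real) (topspace T)"
    have "?z \<in> Cp_ball T ?z K 1"
      using zero_in_Cp by (simp add: Cp_ball_def)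
    then obtain g where g: "g \<in> (\<Union>n. F n)" "g \<in> Cp_ball T ?z K 1"
      using dense_subset_of_meets[OF dF openin_Cp_ball, of K ?z 1] K by blast
    then obtain n where n: "g \<in> F n" by blast
    have "x \<in> W n (c n g)" if "x \<in> K" for x
    proof (rule ccontr)
      assume "x \<notin> W n (c n g)"
      then have "g x = 1"
        using c(2)[of g n x] F n K that by blast
      moreover have "\<bar>g x\<bar> < 1"
        using g(2) K that by (force simp: Cp_ball_def)
      ultimately show False by simp
    qed
    then show "\<exists>n. \<exists>a\<in>c n ` F n. K \<subseteq> W n a"
      using n by blast
  qed
qed

section \<open>From M-separability to S-separability\<close>

text \<open>For the constant sequence \<open>topspace X\<close>, the union of the selected finite
  sets is countable and dense.\<close>

lemma M_separable_imp_separable: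
  assumes "M_separable X"
  obtains C where "countable C" "dense_subset_of X C"
proof -
  have "dense_subset_of X (topspace X)"
    by (simp add: dense_subset_of_def)
  then obtain F where "\<And>n::nat. finite (F n)" "dense_subset_of X (\<Union>n. F n)"
    using assms unfolding M_separable_def by meson
  then show thesis
    by (intro that[of "\<Union>n. F n"]) (auto intro: countable_finite)
qed

lemma M_separable_Cp_imp_S_separable:
  assumes T: "completely_regular_space T" and M: "M_separable (Cp T)"
  shows "S_separable (Cp T)"
  unfolding S_separable_def
proof (intro allI impI)
  fix D :: "nat \<Rightarrow> ('a \<Rightarrow> real) set"
  assume "\<forall>n. dense_subset_of (Cp T) (D n)"
  then have D: "dense_subset_of (Cp T) (D n)" for n by blast
  then have DC: "D n \<subseteq> topspace (Cp T)" for n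
    unfolding dense_subset_of_def by blast
  obtain C where C: "countable C" "dense_subset_of (Cp T) C"
    using M_separable_imp_separable[OF M] .
  define q where "q = from_nat_into C"
  have q: "\<exists>j. q j = c" if "c \<in> C" for c
    using from_nat_into_surj[OF C(1) that] by (auto simp: q_def)
  \<comment> \<open>An index \<open>p\<close> codes a pair \<open>(js, m)\<close>: targets \<open>q (js ! i)\<close> and tolerance \<open>1 / (m + 1)\<close>.
    The dense sets \<open>D (prod_encode (p, j))\<close>, for \<open>j\<close> a natural number, are reserved for \<open>p\<close>.\<close>
  define js :: "nat \<Rightarrow> nat list" where "js p = fst (from_nat p :: nat list \<times> nat)" for p
  define ep :: "nat \<Rightarrow> real" where "ep p = 1 / (real (snd (from_nat p :: nat list \<times> nat)) + 1)" for p
  \<comment> \<open>The cover is indexed by lists of functions, so that a selected index still names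
    the points of the dense set that produced it.\<close>
  define I where
    "I p j = {fs. length fs = length (js p) \<and> set fs \<subseteq> D (prod_encode (p, j))}" for p j
  define W where
    "W p fs = {x \<in> topspace T. \<forall>i<length (js p). \<bar>(fs ! i) x - q (js p ! i) x\<bar> < ep p}" for p fs
  have qC: "q i \<in> topspace (Cp T)" for i
  proof -
    \<comment> \<open>\<open>from_nat_into\<close> stays inside a nonempty set only; the zero
      function makes \<open>Cp T\<close>, and hence \<open>C\<close>, nonempty.\<close>
    have "C \<noteq> {}"
      using dense_subset_of_meets[OF C(2) openin_topspace] zero_in_Cp[of T] by blast
    then show ?thesis
      using C(2) from_nat_into[of C i] by (auto simp: q_def dense_subset_of_def)
  qed
  have "\<exists>G. (\<forall>j. finite (G j) \<and> G j \<subseteq> I p j) \<and>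
    (\<forall>K. finite K \<and> K \<subseteq> topspace T \<longrightarrow> (\<exists>j. \<exists>fs\<in>G j. K \<subseteq> W p fs))" for p
  proof (rule M_separable_Cp_omega_cover_selection[OF T M])
    fix j fs assume fs: "fs \<in> I p j"
    have "openin T {x \<in> topspace T. (fs ! i) x - q (js p ! i) x \<in> {- ep p<..<ep p}}"
      if "i < length (js p)" for i
    proof (rule openin_continuous_map_preimage)
      have "fs ! i \<in> topspace (Cp T)"
        using fs that DC[of "prod_encode (p, j)"] nth_mem[of i fs]
        by (simp add: I_def subset_iff)
      then show "continuous_map T euclideanreal (\<lambda>x. (fs ! i) x - q (js p ! i) x)"
        using qC by (intro continuous_intros) (auto simp: topspace_Cp)
      show "openin euclideanreal {- ep p<..<ep p}"
        by (simp flip: open_openin)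
    qed
    then have "openin T (topspace T \<inter> (\<Inter>i<length (js p).
        {x \<in> topspace T. (fs ! i) x - q (js p ! i) x \<in> {- ep p<..<ep p}}))"
      by (intro openin_Int_Inter) auto
    moreover have "\<bar>t\<bar> < ep p \<longleftrightarrow> t \<in> {- ep p<..<ep p}" for t
      by auto
    then have "topspace T \<inter> (\<Inter>i<length (js p).
        {x \<in> topspace T. (fs ! i) x - q (js p ! i) x \<in> {- ep p<..<ep p}}) = W p fs"
      unfolding W_def by blast
    ultimately show "openin T (W p fs)" by simp
  next
    fix j K assume K: "finite (K :: 'a set)" "K \<subseteq> topspace T"
    have "\<exists>f\<in>D (prod_encode (p, j)). f \<in> Cp_ball T (q i) K (ep p)" for i
    proof (rule dense_subset_of_meets[OF D openin_Cp_ball[OF K]])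
      have "0 < ep p" by (simp add: ep_def add_nonneg_pos)
      then have "q i \<in> Cp_ball T (q i) K (ep p)"
        using qC by (simp add: Cp_ball_def)
      then show "Cp_ball T (q i) K (ep p) \<noteq> {}" by blast
    qed
    then obtain f where f: "\<And>i. f i \<in> D (prod_encode (p, j))"
      "\<And>i. f i \<in> Cp_ball T (q i) K (ep p)"
      by metis
    have "map f (js p) \<in> I p j"
      using f(1) by (auto simp: I_def)
    moreover have "K \<subseteq> W p (map f (js p))"
      using f(2) K by (auto simp: W_def Cp_ball_def)
    ultimately show "\<exists>fs\<in>I p j. K \<subseteq> W p fs" by blast
  qed
  then obtain G where G: "\<And>p j. finite (G p j)" "\<And>p j. G p j \<subseteq> I p j"
    "\<And>p K. finite K \<Longrightarrow> K \<subseteq> topspace T \<Longrightarrow> \<exists>j. \<exists>fs\<in>G p j. K \<subseteq> W p fs"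
    by metis
  \<comment> \<open>All entries of the finitely many lists selected at stage \<open>j\<close> for
    the code \<open>p\<close>.\<close>
  define F where "F n = (case prod_decode n of (p, j) \<Rightarrow> \<Union> (set ` G p j))" for n
  show "S_selection (Cp T) D"
    unfolding S_selection_def
  proof (intro exI[of _ F] conjI allI impI)
    fix n
    obtain p j where pj: "prod_decode n = (p, j)" by fastforce
    then have n: "n = prod_encode (p, j)"
      by (metis prod_decode_inverse)
    show "finite (F n)"
      using G(1) by (simp add: F_def pj)
    show "F n \<subseteq> D n"
      using G(2)[of p j] by (auto simp: F_def pj I_def n)
  next
    fix k and U :: "nat \<Rightarrow> ('a \<Rightarrow> real) set"
    assume U: "\<forall>i<k. openin (Cp T) (U i) \<and> U i \<noteq> {}"
    have "\<exists>j K e. q j \<in> U i \<and> finite K \<and> K \<subseteq> topspace T \<and> 0 < e \<and> Cp_ball T (q j) K e \<subseteq> U i"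
      if i: "i < k" for i
    proof -
      obtain c where "c \<in> C" "c \<in> U i"
        using dense_subset_of_meets[OF C(2), of "U i"] U i by auto
      then obtain j where j: "q j \<in> U i"
        using q by blast
      have "openin (Cp T) (U i)"
        using U i by simp
      from openin_Cp_contains_ball[OF this j] show ?thesis
        using j by metis
    qed
    then obtain s K e where s: "\<And>i. i < k \<Longrightarrow> finite (K i) \<and> K i \<subseteq> topspace T \<and> 0 < e i
        \<and> Cp_ball T (q (s i)) (K i) (e i) \<subseteq> U i"
      by metis
    \<comment> \<open>One tolerance for all \<open>k\<close> neighbourhoods; the inserted 1 covers
      \<open>k = 0\<close>.\<close>
    define d where "d = Min (insert 1 (e ` {..<k}))"
    have "0 < d"
      unfolding d_def using s by (subst Min_gr_iff) auto
    then obtain m where m: "1 / (real m + 1) < d"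
      using reals_Archimedean[of d] by (auto simp: inverse_eq_divide add.commute)
    have de: "d \<le> e i" if "i < k" for i
      unfolding d_def using that by (intro Min_le) auto
    define p where "p = to_nat (map s [0..<k], m)"
    have js: "js p = map s [0..<k]" and ep: "ep p = 1 / (real m + 1)"
      by (simp_all add: p_def js_def ep_def)
    \<comment> \<open>Covering the union of the \<open>K i\<close> by one \<open>W p fs\<close> puts
      approximations to all \<open>k\<close> targets into one list, hence into one
      \<open>F n\<close>.\<close>
    have "finite (\<Union>i<k. K i)" "(\<Union>i<k. K i) \<subseteq> topspace T"
      using s by (auto intro!: UN_least)
    then obtain j fs where fs: "fs \<in> G p j" "(\<Union>i<k. K i) \<subseteq> W p fs"
      using G(3) by blast
    have I: "length fs = k" "set fs \<subseteq> D (prod_encode (p, j))"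
      using fs(1) G(2)[of p j] js by (auto simp: I_def)
    have "fs ! i \<in> U i \<inter> F (prod_encode (p, j))" if "i < k" for i
    proof -
      have mem: "fs ! i \<in> set fs" using I that by simp
      have "\<bar>(fs ! i) x - q (s i) x\<bar> < e i" if "x \<in> K i" for x
      proof -
        have "x \<in> W p fs" using fs(2) that \<open>i < k\<close> by blast
        then have "\<bar>(fs ! i) x - q (s i) x\<bar> < ep p"
          using \<open>i < k\<close> by (auto simp: W_def js dest!: spec[of _ i])
        then show ?thesis using m ep de[OF \<open>i < k\<close>] by linarith
      qed
      moreover have "fs ! i \<in> topspace (Cp T)"
        using mem I(2) DC by blast
      ultimately have "fs ! i \<in> U i"
        using s[OF that] by (auto simp: Cp_ball_def)
      then show ?thesis
        using mem fs(1) by (auto simp: F_def)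
    qed
    then show "\<exists>n. \<forall>i<k. U i \<inter> F n \<noteq> {}"
      by blast
  qed
qed

section \<open>From mS-separability to M-separability\<close>

text \<open>Apply \<open>mS\<close> to the tails \<open>\<Union>m\<ge>n. D m\<close>; a point selected at stage \<open>n\<close> lies in some \<open>D m\<close>
  with \<open>n \<le> m\<close>, so each \<open>D m\<close> receives points from finitely many stages only.\<close>

lemma mS_separable_imp_M_separable:
  assumes "mS_separable X"
  shows "M_separable X"
  unfolding M_separable_def
proof (intro allI impI)
  fix D :: "nat \<Rightarrow> 'a set"
  assume D: "\<forall>n. dense_subset_of X (D n)"
  define E where "E n = (\<Union>m\<in>{n..}. D m)" for n
  have "dense_subset_of X (E n)" for n
  proof (rule dense_subset_ofI)
    show "E n \<subseteq> topspace X"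
      using D by (auto simp: E_def dense_subset_of_def)
    show "\<exists>x\<in>E n. x \<in> U" if "openin X U" "U \<noteq> {}" for U
      using dense_subset_of_meets[of X "D n" U] D that by (auto simp: E_def)
  qed
  moreover have "E (Suc n) \<subseteq> E n" for n
    unfolding E_def by (intro UN_mono) auto
  ultimately have "S_selection X E"
    using assms by (simp add: mS_separable_def)
  then obtain F where F: "\<And>n. finite (F n)" "\<And>n. F n \<subseteq> E n"
    and sel: "\<And>(k::nat) U. (\<forall>i<k. openin X (U i) \<and> U i \<noteq> {}) \<Longrightarrow> \<exists>n. \<forall>i<k. U i \<inter> F n \<noteq> {}"
    unfolding S_selection_def by metis
  define H where "H m = (\<Union>n\<le>m. F n \<inter> D m)" for m
  have "finite (H m)" "H m \<subseteq> D m" for m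
    using F(1) by (auto simp: H_def)
  moreover have "dense_subset_of X (\<Union>m. H m)"
  proof (rule dense_subset_ofI)
    show "(\<Union>m. H m) \<subseteq> topspace X"
      using D by (auto simp: H_def dense_subset_of_def)
    fix U assume U: "openin X U" "U \<noteq> {}"
    \<comment> \<open>Density is the case of a single open set, \<open>k = 1\<close>.\<close>
    then obtain n x where x: "x \<in> U" "x \<in> F n"
      using sel[of 1 "\<lambda>_. U"] by auto
    then obtain m where "n \<le> m" "x \<in> D m"
      using F(2)[of n] by (auto simp: E_def)
    then show "\<exists>x\<in>\<Union>m. H m. x \<in> U"
      using x by (auto simp: H_def)
  qed
  ultimately show "\<exists>F. (\<forall>n. finite (F n) \<and> F n \<subseteq> D n) \<and> dense_subset_of X (\<Union>n. F n)"
    by blast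
qed

lemma S_separable_imp_mS_separable: "S_separable X \<Longrightarrow> mS_separable X"
  by (simp add: S_separable_def mS_separable_def)

theorem theorem1p6:
  fixes T :: "'a topology"
  assumes "tychonoff_space T"
  shows "(S_separable (Cp T) \<longleftrightarrow> mS_separable (Cp T)) \<and>
         (mS_separable (Cp T) \<longleftrightarrow> M_separable (Cp T))"
  using assms M_separable_Cp_imp_S_separable mS_separable_imp_M_separable
    S_separable_imp_mS_separable
  unfolding tychonoff_space_def by blast

end
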